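(* Let $A,B,C$ be a Leonard triple on $V$ that has $q$-Racah type with Huang data $(a,b,c,d)$, and let $W\in\mathrm{End}(V)$ be as defined in the context. Then $$W^2=\sum_{i=0}^d\frac{a^{-i}q^{id}(A-\theta_0I)(A-\theta_1I)\cdots(A-\theta_{i-1}I)}{(q^2;q^2)_i},$$ $$W^{-2}=\sum_{i=0}^d\frac{(-1)^ia^iq^{i(i-d+1)}(A-\theta_0I)(A-\theta_1I)\cdots(A-\theta_{i-1}I)}{(q^2;q^2)_i}.$$
   Context: Let $\mathbb F$ be a field, $d\ge 0$ an integer, $V$ a vector space over $\mathbb F$ of dimension $d+1$, $\mathrm{End}(V)$ the $\mathbb F$-algebra of $\mathbb F$-linear maps $V\to V$, and $I$ its identity. A square matrix is tridiagonal if each nonzero entry lies on the diagonal, subdiagonal or superdiagonal; a tridiagonal matrix is irreducible if every subdiagonal entry and every superdiagonal entry is nonzero. Leonard triple on $V$: a 3-tuple $A,B,C$ of elements of $\mathrm{End}(V)$ such that (i) there is a basis of $V$ with respect to which $A$ is represented by a diagonal matrix and $B,C$ by irreducible tridiagonal matrices; (ii) there is a basis with respect to which $B$ is diagonal and $C,A$ are irreducible tridiagonal; (iii) there is a basis with respect to which $C$ is diagonal and $A,B$ are irreducible tridiagonal. Each of $A,B,C$ is then diagonalizable with one-dimensional eigenspaces. An ordering of the eigenvalues of $A$ is standard if corresponding eigenvectors, in that order, form a basis as in (i); similarly for $B$ with (ii) and $C$ with (iii). Standing assumptions: fix a nonzero $q\in\mathbb F$ with $q^4\ne 1$ and nonzero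 $a,b,c\in\mathbb F$ such that $q^{2i}\ne 1$ for $1\le i\le d$; none of $a^2,b^2,c^2$ is among $q^{2d-2},q^{2d-4},\ldots,q^{2-2d}$; none of $abc,a^{-1}bc,ab^{-1}c,abc^{-1}$ is among $q^{d-1},q^{d-3},\ldots,q^{1-d}$. For $0\le i\le d$ let $\theta_i=aq^{2i-d}+a^{-1}q^{d-2i}$, $\theta'_i=bq^{2i-d}+b^{-1}q^{d-2i}$, $\theta''_i=cq^{2i-d}+c^{-1}q^{d-2i}$. A Leonard triple $A,B,C$ on $V$ has $q$-Racah type with Huang data $(a,b,c,d)$ if $\{\theta_i\}_{i=0}^d$, $\{\theta'_i\}_{i=0}^d$, $\{\theta''_i\}_{i=0}^d$ are standard orderings of the eigenvalues of $A$, $B$, $C$ respectively, and $$A+\frac{qBC-q^{-1}CB}{q^2-q^{-2}}=\alpha_a I,\quad B+\frac{qCA-q^{-1}AC}{q^2-q^{-2}}=\alpha_b I,\quad C+\frac{qAB-q^{-1}BA}{q^2-q^{-2}}=\alpha_c I,$$ where $\alpha_a=\frac{(a+a^{-1})(q^{d+1}+q^{-d-1})+(b+b^{-1})(c+c^{-1})}{q+q^{-1}}$, $\alpha_b=\frac{(b+b^{-1})(q^{d+1}+q^{-d-1})+(c+c^{-1})(a+a^{-1})}{q+q^{-1}}$, $\alpha_c=\frac{(c+c^{-1})(q^{d+1}+q^{-d-1})+(a+a^{-1})(b+b^{-1})}{q+q^{-1}}$. For $0\le i\le d$ let $E_i$ be the primitive idempotent of $A$ for $\theta_i$: the projection of $V$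 onto the $\theta_i$-eigenspace of $A$ that is zero on the other eigenspaces. Define $W=\sum_{i=0}^d(-1)^ia^{-i}q^{i(d-i)}E_i$, which is invertible. For $x,t\in\mathbb F$ and $n\ge 0$, $(x;t)_n=(1-x)(1-xt)\cdots(1-xt^{n-1})$, with $(x;t)_0=1$. The empty product of maps is $I$. *)

theory Defs
  imports Complex_Main
begin

text \<open>
  A matrix indexed by \<open>0..d\<close> is a function \<open>nat \<Rightarrow> nat \<Rightarrow> 'f\<close>; only the entries with
  both indices \<open>\<le> d\<close> matter.
\<close>

definition diagonal :: "nat \<Rightarrow> (nat \<Rightarrow> nat \<Rightarrow> 'f::field) \<Rightarrow> bool" where
  "diagonal d M \<longleftrightarrow> (\<forall>i\<le>d. \<forall>j\<le>d. M i j \<noteq> 0 \<longrightarrow> i = j)"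

definition tridiagonal :: "nat \<Rightarrow> (nat \<Rightarrow> nat \<Rightarrow> 'f::field) \<Rightarrow> bool" where
  "tridiagonal d M \<longleftrightarrow> (\<forall>i\<le>d. \<forall>j\<le>d. M i j \<noteq> 0 \<longrightarrow> i = j \<or> i = Suc j \<or> j = Suc i)"

definition irreducible_tridiagonal :: "nat \<Rightarrow> (nat \<Rightarrow> nat \<Rightarrow> 'f::field) \<Rightarrow> bool" where
  "irreducible_tridiagonal d M \<longleftrightarrow>
     tridiagonal d M \<and> (\<forall>i<d. M (Suc i) i \<noteq> 0 \<and> M i (Suc i) \<noteq> 0)"

definition theta :: "'f::field \<Rightarrow> nat \<Rightarrow> 'f \<Rightarrow> nat \<Rightarrow> 'f" where
  "theta q d a i = a * q powi (2 * int i - int d) + inverse a * q powi (int d - 2 * int i)"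

text \<open>
  \<open>\<alpha>\<^sub>a\<close>, \<open>\<alpha>\<^sub>b\<close>, \<open>\<alpha>\<^sub>c\<close> are \<open>alpha q d a b c\<close>, \<open>alpha q d b c a\<close>, \<open>alpha q d c a b\<close>.
\<close>

definition alpha :: "'f::field \<Rightarrow> nat \<Rightarrow> 'f \<Rightarrow> 'f \<Rightarrow> 'f \<Rightarrow> 'f" where
  "alpha q d a b c =
     ((a + inverse a) * (q powi (int d + 1) + q powi (- int d - 1))
       + (b + inverse b) * (c + inverse c)) / (q + inverse q)"

definition q_pochhammer :: "'f::field \<Rightarrow> 'f \<Rightarrow> nat \<Rightarrow> 'f" where
  "q_pochhammer x t n = (\<Prod>k<n. 1 - x * t ^ k)"

text \<open>
  The excluded values are \<open>q\<^bsup>2d-2\<^esup>, q\<^bsup>2d-4\<^esup>, \<dots>, q\<^bsup>2-2d\<^esup>\<close> for the squares and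
  \<open>q\<^bsup>d-1\<^esup>, q\<^bsup>d-3\<^esup>, \<dots>, q\<^bsup>1-d\<^esup>\<close> for the triple products; both lists are empty if \<open>d = 0\<close>.
\<close>

definition huang_parameters :: "'f::field \<Rightarrow> nat \<Rightarrow> 'f \<Rightarrow> 'f \<Rightarrow> 'f \<Rightarrow> bool" where
  "huang_parameters q d a b c \<longleftrightarrow>
     q \<noteq> 0 \<and> q ^ 4 \<noteq> 1 \<and> a \<noteq> 0 \<and> b \<noteq> 0 \<and> c \<noteq> 0 \<and>
     (\<forall>i\<in>{1..d}. q ^ (2 * i) \<noteq> 1) \<and>
     (\<forall>x\<in>{a, b, c}. \<forall>j\<in>{1 - int d..int d - 1}. x\<^sup>2 \<noteq> q powi (2 * j)) \<and>
     (\<forall>x\<in>{a * b * c, inverse a * b * c, a * inverse b * c, a * b * inverse c}.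
        \<forall>i\<in>{1..d}. x \<noteq> q powi (int d + 1 - 2 * int i))"

locale leonard_space = vector_space scale
  for scale :: "'f::field \<Rightarrow> 'v::ab_group_add \<Rightarrow> 'v" (infixr "*s" 75) +
  fixes d :: nat
  assumes dimension: "dim (UNIV :: 'v set) = d + 1"
begin

definition ordered_basis :: "(nat \<Rightarrow> 'v) \<Rightarrow> bool" where
  "ordered_basis v \<longleftrightarrow>
     inj_on v {..d} \<and> independent (v ` {..d}) \<and> span (v ` {..d}) = UNIV"

definition represented_by :: "(nat \<Rightarrow> 'v) \<Rightarrow> ('v \<Rightarrow> 'v) \<Rightarrow> (nat \<Rightarrow> nat \<Rightarrow> 'f) \<Rightarrow> bool" where
  "represented_by v X M \<longleftrightarrow> (\<forall>j\<le>d. X (v j) = (\<Sum>i\<le>d. M i j *s v i))"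

text \<open>
  Conditions (i), (ii), (iii) of a Leonard triple \<open>A, B, C\<close> are the existence of a
  \<open>leonard_basis\<close> for \<open>A, B, C\<close>, for \<open>B, C, A\<close> and for \<open>C, A, B\<close>.
\<close>

definition leonard_basis ::
    "('v \<Rightarrow> 'v) \<Rightarrow> ('v \<Rightarrow> 'v) \<Rightarrow> ('v \<Rightarrow> 'v) \<Rightarrow> (nat \<Rightarrow> 'v) \<Rightarrow> bool" where
  "leonard_basis X Y Z v \<longleftrightarrow>
     ordered_basis v \<and>
     (\<exists>M. represented_by v X M \<and> diagonal d M) \<and>
     (\<exists>M. represented_by v Y M \<and> irreducible_tridiagonal d M) \<and>
     (\<exists>M. represented_by v Z M \<and> irreducible_tridiagonal d M)"

definition leonard_triple :: "('v \<Rightarrow> 'v) \<Rightarrow> ('v \<Rightarrow> 'v) \<Rightarrow> ('v \<Rightarrow> 'v) \<Rightarrow> bool" where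
  "leonard_triple A B C \<longleftrightarrow>
     Vector_Spaces.linear scale scale A \<and>
     Vector_Spaces.linear scale scale B \<and>
     Vector_Spaces.linear scale scale C \<and>
     (\<exists>v. leonard_basis A B C v) \<and>
     (\<exists>v. leonard_basis B C A v) \<and>
     (\<exists>v. leonard_basis C A B v)"

definition eigenspace :: "('v \<Rightarrow> 'v) \<Rightarrow> 'f \<Rightarrow> 'v set" where
  "eigenspace X x = {v. X v = x *s v}"

definition eigenvalues :: "('v \<Rightarrow> 'v) \<Rightarrow> 'f set" where
  "eigenvalues X = {x. \<exists>v. v \<noteq> 0 \<and> v \<in> eigenspace X x}"

definition standard_ordering ::
    "('v \<Rightarrow> 'v) \<Rightarrow> ('v \<Rightarrow> 'v) \<Rightarrow> ('v \<Rightarrow> 'v) \<Rightarrow> (nat \<Rightarrow> 'f) \<Rightarrow> bool" where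
  "standard_ordering X Y Z t \<longleftrightarrow>
     bij_betw t {..d} (eigenvalues X) \<and>
     (\<exists>v. leonard_basis X Y Z v \<and> (\<forall>i\<le>d. v i \<in> eigenspace X (t i)))"

definition q_racah_relation ::
    "'f \<Rightarrow> ('v \<Rightarrow> 'v) \<Rightarrow> ('v \<Rightarrow> 'v) \<Rightarrow> ('v \<Rightarrow> 'v) \<Rightarrow> 'f \<Rightarrow> bool" where
  "q_racah_relation q X Y Z r \<longleftrightarrow>
     (\<forall>v. X v + inverse (q powi 2 - q powi (-2)) *s (q *s Y (Z v) - inverse q *s Z (Y v)) = r *s v)"

definition q_racah_leonard_triple ::
    "'f \<Rightarrow> 'f \<Rightarrow> 'f \<Rightarrow> 'f \<Rightarrow> ('v \<Rightarrow> 'v) \<Rightarrow> ('v \<Rightarrow> 'v) \<Rightarrow> ('v \<Rightarrow> 'v) \<Rightarrow> bool" where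
  "q_racah_leonard_triple q a b c A B C \<longleftrightarrow>
     leonard_triple A B C \<and>
     standard_ordering A B C (theta q d a) \<and>
     standard_ordering B C A (theta q d b) \<and>
     standard_ordering C A B (theta q d c) \<and>
     q_racah_relation q A B C (alpha q d a b c) \<and>
     q_racah_relation q B C A (alpha q d b c a) \<and>
     q_racah_relation q C A B (alpha q d c a b)"

text \<open>Existence and uniqueness of the projection hold whenever \<open>X\<close> is diagonalizable.\<close>

definition primitive_idempotent :: "('v \<Rightarrow> 'v) \<Rightarrow> 'f \<Rightarrow> 'v \<Rightarrow> 'v" where
  "primitive_idempotent X x =
     (THE E. Vector_Spaces.linear scale scale E \<and>
             range E = eigenspace X x \<and>
             (\<forall>v\<in>eigenspace X x. E v = v) \<and>
             (\<forall>y. y \<noteq> x \<longrightarrow> (\<forall>v\<in>eigenspace X y. E v = 0)))"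

definition W_map :: "'f \<Rightarrow> 'f \<Rightarrow> ('v \<Rightarrow> 'v) \<Rightarrow> 'v \<Rightarrow> 'v" where
  "W_map q a A v =
     (\<Sum>i\<le>d. ((-1) ^ i * a powi (- int i) * q powi (int i * (int d - int i)))
               *s primitive_idempotent A (theta q d a i) v)"

text \<open>\<open>shifted_product X t i\<close> is \<open>(X - t\<^sub>0 I)(X - t\<^sub>1 I)\<dots>(X - t\<^bsub>i-1\<^esub> I)\<close>.\<close>

primrec shifted_product :: "('v \<Rightarrow> 'v) \<Rightarrow> (nat \<Rightarrow> 'f) \<Rightarrow> nat \<Rightarrow> 'v \<Rightarrow> 'v" where
  "shifted_product X t 0 = id"
| "shifted_product X t (Suc i) = shifted_product X t i \<circ> (\<lambda>v. X v - t i *s v)"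

end

end

theory Submission
  imports Defs
begin

text \<open>
  All maps in the statement are polynomials in \<open>A\<close>, and \<open>A\<close> has an eigenbasis
  \<open>v\<^sub>0, \<dots>, v\<^sub>d\<close> with distinct eigenvalues \<open>\<theta>\<^sub>0, \<dots>, \<theta>\<^sub>d\<close>. On \<open>v\<^sub>j\<close> the map \<open>W\<close> acts as
  the nonzero scalar \<open>w\<^sub>j = (-1)\<^sup>j a\<^bsup>-j\<^esup> q\<^bsup>j(d-j)\<^esup>\<close>, and the product
  \<open>(A - \<theta>\<^sub>0) \<dots> (A - \<theta>\<^bsub>i-1\<^esub>)\<close> acts as \<open>(\<theta>\<^sub>j - \<theta>\<^sub>0) \<dots> (\<theta>\<^sub>j - \<theta>\<^bsub>i-1\<^esub>)\<close>. The theorem therefore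
  amounts to two scalar identities, which evaluate a finite sum as \<open>w\<^sub>j\<^sup>2\<close> and as \<open>w\<^sub>j\<^bsup>-2\<^esup>\<close>.

  Put \<open>t = q\<^sup>2\<close>. The difference \<open>\<theta>\<^sub>j - \<theta>\<^sub>k\<close> splits, up to a monomial, as
  \<open>(1 - t\<^bsup>k-j\<^esup>) (1 - \<beta> t\<^sup>k)\<close> with \<open>\<beta> = a\<^sup>2 t\<^bsup>j-d\<^esup>\<close>. After this splitting the sum for
  \<open>W\<^bsup>-2\<^esup>\<close> is the left side of the \<open>q\<close>-Chu-Vandermonde identity with lower parameter zero,
  \[\sum_{i=0}^{j} t^i \frac{(t^{-j};t)_i (\beta;t)_i}{(t;t)_i} = \beta^j,\]
  and \<open>\<beta>\<^sup>j = w\<^sub>j\<^bsup>-2\<^esup>\<close>. The sum for \<open>W\<^sup>2\<close> is the same sum with \<open>t\<close> and \<open>\<beta>\<close> replaced by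
  their inverses, so its value is \<open>\<beta>\<^bsup>-j\<^esup> = w\<^sub>j\<^sup>2\<close>. Thus a single summation theorem,
  \<open>q_chu_vandermonde_zero\<close>, proves both formulas.
\<close>

section \<open>A \<open>q\<close>-Chu-Vandermonde sum\<close>

text \<open>
  The summand is kept as one product so that it can be compared factor by factor with
  products of eigenvalue differences.
\<close>

definition vandermonde_term :: "'f::field \<Rightarrow> nat \<Rightarrow> 'f \<Rightarrow> nat \<Rightarrow> 'f" where
  "vandermonde_term t n x i =
     (\<Prod>k<i. t * (1 - t ^ k / t ^ n) * (1 - x * t ^ k) / (1 - t ^ Suc k))"

lemma vandermonde_term_eq_0:
  assumes "t \<noteq> 0" "n < i"
  shows "vandermonde_term t n x i = 0"
  unfolding vandermonde_term_def using assms by (intro prod_zero) auto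

text \<open>
  The Pascal-type recurrence behind the induction on \<open>n\<close>: the quantity
  \<open>(t\<^bsup>-n-1\<^esup>;t)\<^bsub>i+1\<^esub> - (t\<^bsup>-n\<^esup>;t)\<^bsub>i+1\<^esub>\<close> is a multiple of \<open>(1 - t\<^bsup>i+1\<^esup>) (t\<^bsup>-n\<^esup>;t)\<^sub>i\<close>, and the factor
  \<open>1 - t\<^bsup>i+1\<^esup>\<close> cancels against the denominator.
\<close>

lemma vandermonde_term_contiguous:
  fixes t x :: "'f::field"
  assumes t: "t \<noteq> 0" and ne: "t ^ Suc i \<noteq> 1"
  shows "vandermonde_term t (Suc n) x (Suc i) =
    vandermonde_term t n x (Suc i) - (1 - x) / t ^ n * vandermonde_term t n (x * t) i"
proof -
  define U where "U n i = (\<Prod>k<i. 1 - t ^ k / t ^ n)" for n i :: nat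
  define X where "X x i = (\<Prod>k<i. 1 - x * t ^ k)" for x :: 'f and i :: nat
  define D where "D i = (\<Prod>k<i. 1 - t ^ Suc k)" for i :: nat
  have split: "vandermonde_term t n x i = t ^ i * U n i * X x i / D i" for n x i
    unfolding vandermonde_term_def U_def X_def D_def
    by (simp add: prod.distrib prod_dividef)
  have U1: "U (Suc n) (Suc i) = (1 - 1 / t ^ Suc n) * U n i"
    unfolding U_def by (subst prod.lessThan_Suc_shift) (simp add: t)
  have U2: "U n (Suc i) = U n i * (1 - t ^ i / t ^ n)"
    unfolding U_def by simp
  have X1: "X x (Suc i) = (1 - x) * X (x * t) i"
    unfolding X_def by (subst prod.lessThan_Suc_shift) (simp add: mult.assoc)
  have D1: "D (Suc i) = D i * (1 - t ^ Suc i)"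
    unfolding D_def by simp
  have r: "t * (1 - 1 / t ^ Suc n) = t * (1 - t ^ i / t ^ n) - (1 - t ^ Suc i) / t ^ n"
    using t by (simp add: field_simps)
  have "vandermonde_term t (Suc n) x (Suc i) =
      t ^ i * U n i * ((1 - x) * X (x * t) i) / (D i * (1 - t ^ Suc i))
        * (t * (1 - 1 / t ^ Suc n))"
    unfolding split U1 X1 D1 by simp
  also have "\<dots> = t ^ i * U n i * ((1 - x) * X (x * t) i) / (D i * (1 - t ^ Suc i))
        * (t * (1 - t ^ i / t ^ n))
      - t ^ i * U n i * ((1 - x) * X (x * t) i) / (D i * (1 - t ^ Suc i))
        * ((1 - t ^ Suc i) / t ^ n)"
    unfolding r by (simp only: right_diff_distrib)
  also have "\<dots> = vandermonde_term t n x (Suc i)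
      - (1 - x) / t ^ n * vandermonde_term t n (x * t) i"
    unfolding split U2 X1 D1 using ne by (simp add: mult_ac)
  finally show ?thesis .
qed

text \<open>
  Summing the recurrence turns the sum \<open>F\<^sub>n(x)\<close> into
  \<open>F\<^bsub>n+1\<^esub>(x) = F\<^sub>n(x) - (1 - x) t\<^bsup>-n\<^esup> F\<^sub>n(xt) = x\<^sup>n - (1 - x) x\<^sup>n = x\<^bsup>n+1\<^esup>\<close>.
\<close>

theorem q_chu_vandermonde_zero:
  fixes t x :: "'f::field"
  assumes t: "t \<noteq> 0" and ne: "\<And>k. 1 \<le> k \<Longrightarrow> k \<le> n \<Longrightarrow> t ^ k \<noteq> 1"
  shows "(\<Sum>i\<le>n. vandermonde_term t n x i) = x ^ n"
  using ne
proof (induction n arbitrary: x)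
  case 0
  show ?case by (simp add: vandermonde_term_def)
next
  case (Suc n)
  have IH: "(\<Sum>i\<le>n. vandermonde_term t n x i) = x ^ n" for x
    using Suc by simp
  have one: "vandermonde_term t m x 0 = 1" for m
    by (simp add: vandermonde_term_def)
  have "(\<Sum>i\<le>Suc n. vandermonde_term t (Suc n) x i)
      = 1 + (\<Sum>i\<le>n. vandermonde_term t (Suc n) x (Suc i))"
    unfolding sum.atMost_Suc_shift one ..
  also have "(\<Sum>i\<le>n. vandermonde_term t (Suc n) x (Suc i)) =
      (\<Sum>i\<le>n. vandermonde_term t n x (Suc i)
        - (1 - x) / t ^ n * vandermonde_term t n (x * t) i)"
  proof (rule sum.cong[OF refl])
    fix i assume "i \<in> {..n}"
    then have "t ^ Suc i \<noteq> 1" by (intro Suc.prems) auto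
    then show "vandermonde_term t (Suc n) x (Suc i) = vandermonde_term t n x (Suc i)
        - (1 - x) / t ^ n * vandermonde_term t n (x * t) i"
      by (rule vandermonde_term_contiguous[OF t])
  qed
  also have "1 + \<dots> = (\<Sum>i\<le>Suc n. vandermonde_term t n x i)
      - (1 - x) / t ^ n * (\<Sum>i\<le>n. vandermonde_term t n (x * t) i)"
    unfolding sum.atMost_Suc_shift one by (simp add: sum_subtractf sum_distrib_left)
  also have "(\<Sum>i\<le>Suc n. vandermonde_term t n x i) = x ^ n"
    using IH vandermonde_term_eq_0[OF t, of n "Suc n" x] by simp
  also have "x ^ n - (1 - x) / t ^ n * (\<Sum>i\<le>n. vandermonde_term t n (x * t) i) = x ^ Suc n"
    unfolding IH using t by (simp add: field_simps)
  finally show ?case .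
qed

lemma q_chu_vandermonde_zero_extended:
  fixes t x :: "'f::field"
  assumes t: "t \<noteq> 0" and ne: "\<And>k. 1 \<le> k \<Longrightarrow> k \<le> n \<Longrightarrow> t ^ k \<noteq> 1" and "n \<le> m"
  shows "(\<Sum>i\<le>m. vandermonde_term t n x i) = x ^ n"
proof -
  have "(\<Sum>i\<le>m. vandermonde_term t n x i) = (\<Sum>i\<le>n. vandermonde_term t n x i)"
    using \<open>n \<le> m\<close> vandermonde_term_eq_0[OF t] by (intro sum.mono_neutral_right) auto
  then show ?thesis using q_chu_vandermonde_zero[OF t ne] by simp
qed

section \<open>The eigenvalues of \<open>W\<^sup>2\<close> and its inverse\<close>

lemma theta_nat_powers:
  assumes "q \<noteq> 0"
  shows "theta q d a i = a * ((q\<^sup>2) ^ i / q ^ d) + inverse a * (q ^ d / (q\<^sup>2) ^ i)"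
proof -
  have "q powi (2 * int i) = (q\<^sup>2) ^ i"
    by (metis (mono_tags) of_nat_mult of_nat_numeral power_int_of_nat power_mult)
  then show ?thesis using assms unfolding theta_def by (simp add: power_int_diff)
qed

lemma theta_difference_factor:
  fixes q a :: "'f::field"
  assumes "q \<noteq> 0" "a \<noteq> 0"
  shows "- (a / q ^ d) * (q\<^sup>2) ^ Suc k * (theta q d a j - theta q d a k) =
    q\<^sup>2 * (1 - (q\<^sup>2) ^ k / (q\<^sup>2) ^ j) * (1 - (a\<^sup>2 * (q\<^sup>2) ^ j / (q\<^sup>2) ^ d) * (q\<^sup>2) ^ k)"
proof -
  define u x e where "u = (q\<^sup>2) ^ j" and "x = (q\<^sup>2) ^ k" and "e = q ^ d"
  have nz: "u \<noteq> 0" "x \<noteq> 0" "e \<noteq> 0" using assms by (auto simp: u_def x_def e_def)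
  have e2: "(q\<^sup>2) ^ d = e\<^sup>2" by (simp add: e_def power_mult[symmetric] mult.commute)
  have "- (a / e) * x * (a * (u / e) + inverse a * (e / u) - (a * (x / e) + inverse a * (e / x)))
      = (1 - x / u) * (1 - (a\<^sup>2 * u / e\<^sup>2) * x)"
    using nz \<open>a \<noteq> 0\<close> by (simp add: field_simps power2_eq_square)
  then show ?thesis
    unfolding theta_nat_powers[OF assms(1)] e2 power_Suc
      u_def[symmetric] x_def[symmetric] e_def[symmetric]
    by (simp only: mult.assoc mult.left_commute[of _ "q\<^sup>2"])
qed

text \<open>The same splitting written with \<open>q\<^bsup>-2\<^esup>\<close> as base, which is the one fitting \<open>W\<^sup>2\<close>.\<close>

lemma theta_difference_factor_inverse:
  fixes q a :: "'f::field"
  assumes "q \<noteq> 0" "a \<noteq> 0" and ne: "(q\<^sup>2) ^ Suc k \<noteq> 1"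
  shows "inverse a * q ^ d * (theta q d a j - theta q d a k) / (1 - (q\<^sup>2) ^ Suc k) =
    inverse (q\<^sup>2) * (1 - inverse (q\<^sup>2) ^ k / inverse (q\<^sup>2) ^ j)
      * (1 - inverse (a\<^sup>2 * (q\<^sup>2) ^ j / (q\<^sup>2) ^ d) * inverse (q\<^sup>2) ^ k)
      / (1 - inverse (q\<^sup>2) ^ Suc k)"
proof -
  define t where "t = q\<^sup>2"
  define u x e where "u = t ^ j" and "x = t ^ k" and "e = q ^ d"
  have nz: "u \<noteq> 0" "x \<noteq> 0" "e \<noteq> 0" "t \<noteq> 0"
    using assms by (auto simp: u_def x_def e_def t_def)
  have e2: "t ^ d = e\<^sup>2" by (simp add: t_def e_def power_mult[symmetric] mult.commute)
  have ne': "t * x \<noteq> 1" using ne by (simp add: t_def x_def)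
  have d: "1 - inverse t * inverse x = - (1 - t * x) / (t * x)"
    using nz by (simp add: field_simps)
  have n: "inverse a * e * (a * (u / e) + inverse a * (e / u) - (a * (x / e) + inverse a * (e / x)))
      = - x * ((1 - inverse x / inverse u) * (1 - inverse (a\<^sup>2 * u / e\<^sup>2) * inverse x))"
    using nz \<open>a \<noteq> 0\<close> by (simp add: field_simps power2_eq_square)
  have "inverse a * e * (a * (u / e) + inverse a * (e / u) - (a * (x / e) + inverse a * (e / x)))
      / (1 - t * x) = inverse t * (1 - inverse x / inverse u)
      * (1 - inverse (a\<^sup>2 * u / e\<^sup>2) * inverse x) / (1 - inverse t * inverse x)"
    unfolding n d using nz ne' by (simp add: divide_simps) (simp add: algebra_simps)
  then show ?thesis
    unfolding theta_nat_powers[OF assms(1)] power_Suc power_inverse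
      t_def[symmetric] u_def[symmetric] x_def[symmetric] e_def[symmetric] e2 .
qed

definition W_eigenvalue :: "'f::field \<Rightarrow> nat \<Rightarrow> 'f \<Rightarrow> nat \<Rightarrow> 'f" where
  "W_eigenvalue q d a j =
     (-1) ^ j * a powi (- int j) * q powi (int j * (int d - int j))"

lemma W_eigenvalue_nonzero:
  "q \<noteq> 0 \<Longrightarrow> a \<noteq> 0 \<Longrightarrow> W_eigenvalue q d a j \<noteq> 0"
  by (simp add: W_eigenvalue_def)

lemma W_eigenvalue_square:
  fixes q a :: "'f::field"
  assumes "q \<noteq> 0" "a \<noteq> 0"
  shows "(W_eigenvalue q d a j)\<^sup>2 = inverse (a\<^sup>2 * (q\<^sup>2) ^ j / (q\<^sup>2) ^ d) ^ j"
proof -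
  have "q powi (int j * (int d - int j)) = (q ^ d / q ^ j) ^ j"
    using assms by (simp add: power_int_mult power_int_diff mult.commute[of "int j"])
  moreover have "a powi (- int j) = inverse a ^ j"
    by (simp add: power_int_minus power_inverse)
  moreover have "((-1 :: 'f) ^ j)\<^sup>2 = 1"
    by (simp add: power_mult[symmetric])
  ultimately have "(W_eigenvalue q d a j)\<^sup>2 = ((inverse a ^ j)\<^sup>2) * (((q ^ d / q ^ j) ^ j)\<^sup>2)"
    by (simp add: W_eigenvalue_def power_mult_distrib)
  also have "\<dots> = ((inverse a)\<^sup>2 * (q ^ d / q ^ j)\<^sup>2) ^ j"
    by (simp add: power_mult_distrib power_mult[symmetric] mult.commute)
  also have "(inverse a)\<^sup>2 * (q ^ d / q ^ j)\<^sup>2 = inverse (a\<^sup>2 * (q\<^sup>2) ^ j / (q\<^sup>2) ^ d)"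
    using assms
    by (simp add: field_simps power_mult_distrib power_mult[symmetric] mult.commute)
  finally show ?thesis .
qed

lemma q_pochhammer_self: "q_pochhammer t t i = (\<Prod>k<i. 1 - t ^ Suc k)"
  by (simp add: q_pochhammer_def)

lemma W_square_scalar_sum:
  fixes q a :: "'f::field"
  assumes q: "q \<noteq> 0" and a: "a \<noteq> 0" and "j \<le> d"
    and ne: "\<forall>k\<in>{1..d}. (q\<^sup>2) ^ k \<noteq> 1"
  shows "(\<Sum>i\<le>d. (a powi (- int i) * q powi (int i * int d) / q_pochhammer (q\<^sup>2) (q\<^sup>2) i)
      * (\<Prod>k<i. theta q d a j - theta q d a k)) = (W_eigenvalue q d a j)\<^sup>2"
proof -
  define t where "t = inverse (q\<^sup>2)"
  define x where "x = inverse (a\<^sup>2 * (q\<^sup>2) ^ j / (q\<^sup>2) ^ d)"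
  have term_eq: "(a powi (- int i) * q powi (int i * int d) / q_pochhammer (q\<^sup>2) (q\<^sup>2) i)
      * (\<Prod>k<i. theta q d a j - theta q d a k) = vandermonde_term t j x i" if "i \<le> d" for i
  proof -
    have "a powi (- int i) * q powi (int i * int d) = (inverse a * q ^ d) ^ i"
      by (simp add: power_int_minus power_int_mult power_inverse power_mult_distrib
          mult.commute[of "int i"])
    also have "\<dots> = (\<Prod>k<i. inverse a * q ^ d)" by simp
    finally have "(a powi (- int i) * q powi (int i * int d) / q_pochhammer (q\<^sup>2) (q\<^sup>2) i)
        * (\<Prod>k<i. theta q d a j - theta q d a k) =
      (\<Prod>k<i. inverse a * q ^ d * (theta q d a j - theta q d a k) / (1 - (q\<^sup>2) ^ Suc k))"
      unfolding q_pochhammer_self by (simp only: prod.distrib prod_dividef times_divide_eq_left)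
    also have "\<dots> = vandermonde_term t j x i"
      unfolding vandermonde_term_def t_def x_def
    proof (intro prod.cong refl theta_difference_factor_inverse[OF q a])
      fix k assume "k \<in> {..<i}"
      then show "(q\<^sup>2) ^ Suc k \<noteq> 1" using that by (intro bspec[OF ne]) auto
    qed
    finally show ?thesis .
  qed
  have "(\<Sum>i\<le>d. vandermonde_term t j x i) = x ^ j"
  proof (rule q_chu_vandermonde_zero_extended[OF _ _ \<open>j \<le> d\<close>])
    show "t \<noteq> 0" using q by (simp add: t_def)
    fix k assume "1 \<le> k" "k \<le> j"
    then have "(q\<^sup>2) ^ k \<noteq> 1" using ne \<open>j \<le> d\<close> by simp
    then show "t ^ k \<noteq> 1" unfolding t_def power_inverse by (metis inverse_1 inverse_inverse_eq)
  qed
  then show ?thesis using term_eq W_eigenvalue_square[OF q a] by (simp add: x_def)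
qed

lemma W_inverse_square_scalar_sum:
  fixes q a :: "'f::field"
  assumes q: "q \<noteq> 0" and a: "a \<noteq> 0" and "j \<le> d"
    and ne: "\<forall>k\<in>{1..d}. (q\<^sup>2) ^ k \<noteq> 1"
  shows "(\<Sum>i\<le>d. ((-1) ^ i * a powi int i * q powi (int i * (int i - int d + 1))
              / q_pochhammer (q\<^sup>2) (q\<^sup>2) i)
      * (\<Prod>k<i. theta q d a j - theta q d a k)) = inverse ((W_eigenvalue q d a j)\<^sup>2)"
proof -
  define x where "x = a\<^sup>2 * (q\<^sup>2) ^ j / (q\<^sup>2) ^ d"
  \<comment> \<open>The exponent \<open>i (i - d + 1)\<close> is the sum of \<open>2 (k + 1) - d\<close> over \<open>k < i\<close>, so the monomial
    distributes over the factors.\<close>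
  have monomial: "(-1) ^ i * a powi int i * q powi (int i * (int i - int d + 1))
      = (\<Prod>k<i. - (a / q ^ d) * (q\<^sup>2) ^ Suc k)" for i
  proof (induction i)
    case (Suc i)
    have "int (Suc i) * (int (Suc i) - int d + 1)
        = int i * (int i - int d + 1) + (int (2 * Suc i) - int d)"
      by (simp add: algebra_simps)
    then have "q powi (int (Suc i) * (int (Suc i) - int d + 1))
        = q powi (int i * (int i - int d + 1)) * (q powi int (2 * Suc i) / q powi int d)"
      by (simp only: power_int_add power_int_diff q simp_thms)
    also have "q powi int (2 * Suc i) / q powi int d = (q\<^sup>2) ^ Suc i / q ^ d"
      by (simp only: power_int_of_nat power_mult)
    finally have "(-1) ^ Suc i * a powi int (Suc i)
          * q powi (int (Suc i) * (int (Suc i) - int d + 1)) =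
        ((-1) ^ i * a powi int i * q powi (int i * (int i - int d + 1)))
          * (- (a / q ^ d) * (q\<^sup>2) ^ Suc i)"
      by (simp only: power_int_of_nat power_Suc) simp
    then show ?case unfolding Suc.IH by simp
  qed simp
  have "((-1) ^ i * a powi int i * q powi (int i * (int i - int d + 1))
        / q_pochhammer (q\<^sup>2) (q\<^sup>2) i)
      * (\<Prod>k<i. theta q d a j - theta q d a k) = vandermonde_term (q\<^sup>2) j x i" for i
  proof -
    have "((-1) ^ i * a powi int i * q powi (int i * (int i - int d + 1))
        / q_pochhammer (q\<^sup>2) (q\<^sup>2) i)
      * (\<Prod>k<i. theta q d a j - theta q d a k) =
      (\<Prod>k<i. - (a / q ^ d) * (q\<^sup>2) ^ Suc k * (theta q d a j - theta q d a k)
        / (1 - (q\<^sup>2) ^ Suc k))"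
      unfolding q_pochhammer_self monomial
      by (simp only: prod.distrib prod_dividef times_divide_eq_left)
    then show ?thesis
      unfolding theta_difference_factor[OF q a] vandermonde_term_def x_def .
  qed
  moreover have "(\<Sum>i\<le>d. vandermonde_term (q\<^sup>2) j x i) = x ^ j"
    using q ne \<open>j \<le> d\<close> by (intro q_chu_vandermonde_zero_extended) auto
  ultimately show ?thesis
    unfolding W_eigenvalue_square[OF q a] power_inverse inverse_inverse_eq x_def by simp
qed

section \<open>Maps diagonalized by a common basis\<close>

context leonard_space
begin

lemma linear_iff_additive_homogeneous:
  "Vector_Spaces.linear scale scale f \<longleftrightarrow>
    (\<forall>x y. f (x + y) = f x + f y) \<and> (\<forall>r x. f (r *s x) = r *s f x)"
  using vector_space_axioms by (auto simp: Vector_Spaces.linear_iff)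

lemma linear_combination_linear:
  assumes "\<And>i. i \<in> I \<Longrightarrow> Vector_Spaces.linear scale scale (f i)"
  shows "Vector_Spaces.linear scale scale (\<lambda>v. \<Sum>i\<in>I. r i *s f i v)"
  using assms unfolding linear_iff_additive_homogeneous
  by (simp add: scale_right_distrib sum.distrib scale_sum_right mult.commute)

lemma shifted_product_linear:
  assumes "Vector_Spaces.linear scale scale X"
  shows "Vector_Spaces.linear scale scale (shifted_product X t i)"
proof (induction i)
  case 0
  then show ?case by (simp add: linear_iff_additive_homogeneous)
next
  case (Suc i)
  have "Vector_Spaces.linear scale scale (\<lambda>v. X v - t i *s v)"
    using assms by (simp add: linear_iff_additive_homogeneous scale_right_distrib
        scale_right_diff_distrib mult.commute)
  then show ?case
    unfolding shifted_product.simps by (rule Vector_Spaces.linear_compose[OF _ Suc])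
qed

lemma shifted_product_eigenvector:
  assumes X: "Vector_Spaces.linear scale scale X" and v: "X v = x *s v"
  shows "shifted_product X t i v = (\<Prod>k<i. x - t k) *s v"
proof (induction i)
  case (Suc i)
  have "X v - t i *s v = (x - t i) *s v" by (simp add: v scale_left_diff_distrib)
  then show ?case
    using shifted_product_linear[OF X, of t i] Suc
    by (simp add: linear_iff_additive_homogeneous mult.commute)
qed simp

lemma linear_eq_on_ordered_basis:
  assumes "ordered_basis v"
    and "Vector_Spaces.linear scale scale f" "Vector_Spaces.linear scale scale g"
    and "\<And>j. j \<le> d \<Longrightarrow> f (v j) = g (v j)"
  shows "f = g"
proof -
  interpret vector_space_pair scale scale ..
  show ?thesis
  proof
    fix x
    have "x \<in> span (v ` {..d})" using assms(1) by (simp add: ordered_basis_def)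
    then show "f x = g x" using assms by (intro linear_eq_on[of f g x]) auto
  qed
qed

text \<open>
  The witness for the description of \<open>primitive_idempotent\<close> is the coordinate projection
  onto the line spanned by \<open>v\<^sub>i\<close>. The coordinates of an eigenvector for \<open>y\<close> vanish at all
  indices \<open>k\<close> with \<open>t k \<noteq> y\<close>, which gives both the range and the kernel condition.
\<close>

lemma primitive_idempotent_eigenbasis:
  assumes basis: "ordered_basis v" and t: "inj_on t {..d}"
    and X: "Vector_Spaces.linear scale scale X"
    and eig: "\<And>j. j \<le> d \<Longrightarrow> X (v j) = t j *s v j" and i: "i \<le> d"
  shows "Vector_Spaces.linear scale scale (primitive_idempotent X (t i))" (is ?lin)
    and "\<And>j. j \<le> d \<Longrightarrow> primitive_idempotent X (t i) (v j) = (if j = i then v j else 0)"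
      (is "\<And>j. _ \<Longrightarrow> ?val j")
proof -
  let ?B = "v ` {..d}"
  have inj: "inj_on v {..d}" and ind: "independent ?B" and span: "span ?B = UNIV"
    using basis by (auto simp: ordered_basis_def)
  define co where "co k x = representation ?B x (v k)" for k x
  define E where "E x = co i x *s v i" for x
  have co_add: "co k (x + y) = co k x + co k y" and co_scale: "co k (r *s x) = r * co k x"
    for k x y r
    using ind span by (simp_all add: co_def representation_add representation_scale)
  have co_basis: "co k (v j) = (if j = k then 1 else 0)" if "j \<le> d" "k \<le> d" for j k
    using that ind inj by (auto simp: co_def representation_basis inj_on_eq_iff)
  have expand: "(\<Sum>k\<le>d. co k x *s v k) = x" for x
    using sum_representation_eq[OF ind, of x ?B] span inj
    by (simp add: co_def sum.reindex)
  have co_linear: "Vector_Spaces.linear scale scale (\<lambda>x. co k x *s v k)" for k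
    unfolding linear_iff_additive_homogeneous
    by (simp add: co_add co_scale scale_left_distrib)
  have E_linear: "Vector_Spaces.linear scale scale E"
    using co_linear[of i] by (simp add: E_def[abs_def])
  have co_X: "co k (X x) = t k * co k x" if k: "k \<le> d" for k x
  proof -
    have "(\<lambda>x. co k (X x) *s v k) = (\<lambda>x. (t k * co k x) *s v k)"
    proof (rule linear_eq_on_ordered_basis[OF basis])
      show "Vector_Spaces.linear scale scale (\<lambda>x. co k (X x) *s v k)"
        using X unfolding linear_iff_additive_homogeneous
        by (simp add: co_add co_scale scale_left_distrib)
      show "Vector_Spaces.linear scale scale (\<lambda>x. (t k * co k x) *s v k)"
        unfolding linear_iff_additive_homogeneous
        by (simp add: co_add co_scale scale_left_distrib distrib_left mult.left_commute)
      show "co k (X (v j)) *s v k = (t k * co k (v j)) *s v k" if "j \<le> d" for j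
        using that k by (simp add: eig co_scale co_basis)
    qed
    then have "co k (X x) *s v k = (t k * co k x) *s v k" by metis
    moreover have "v k \<noteq> 0" using ind k dependent_zero by (metis atMost_iff imageI)
    ultimately show ?thesis by simp
  qed
  have co_eigen: "co k x = 0" if "X x = y *s x" "k \<le> d" "t k \<noteq> y" for k x y
    using co_X[OF that(2), of x] that by (simp add: co_scale)
  have eigen_line: "x = E x" if "X x = t i *s x" for x
  proof -
    have "co k x *s v k = (if k = i then E x else 0)" if "k \<le> d" for k
      using co_eigen[OF \<open>X x = _\<close> that] that t i by (auto simp: E_def inj_on_eq_iff)
    then have "(\<Sum>k\<le>d. co k x *s v k) = (\<Sum>k\<le>d. if k = i then E x else 0)"
      by (intro sum.cong) auto
    then show ?thesis using i by (simp add: expand)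
  qed
  let ?P = "\<lambda>E. Vector_Spaces.linear scale scale E \<and> range E = eigenspace X (t i) \<and>
     (\<forall>v\<in>eigenspace X (t i). E v = v) \<and>
     (\<forall>y. y \<noteq> t i \<longrightarrow> (\<forall>v\<in>eigenspace X y. E v = 0))"
  have range_E: "range E = eigenspace X (t i)"
  proof
    show "range E \<subseteq> eigenspace X (t i)"
      using X i eig by (auto simp: E_def eigenspace_def linear_iff_additive_homogeneous
          scale_left_commute)
    show "eigenspace X (t i) \<subseteq> range E"
      using eigen_line by (auto simp: eigenspace_def)
  qed
  have PE: "?P E"
    using E_linear range_E eigen_line co_eigen[OF _ i]
    by (auto simp: eigenspace_def E_def)
  have val: "F (v j) = (if j = i then v j else 0)" if "?P F" "j \<le> d" for F j
  proof -
    have "v j \<in> eigenspace X (t j)" using eig that(2) by (simp add: eigenspace_def)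
    moreover have "t j = t i \<longleftrightarrow> j = i" using t that(2) i by (simp add: inj_on_eq_iff)
    ultimately show ?thesis using that(1) by auto
  qed
  have "primitive_idempotent X (t i) = E"
    unfolding primitive_idempotent_def
  proof (rule the_equality)
    show "?P E" by (rule PE)
    fix F assume F: "?P F"
    show "F = E"
    proof (rule linear_eq_on_ordered_basis[OF basis])
      show "F (v j) = E (v j)" if "j \<le> d" for j
        using val[OF F that] val[OF PE that] by simp
    qed (use F PE in auto)
  qed
  then show ?lin and "\<And>j. j \<le> d \<Longrightarrow> ?val j" using PE val[OF PE] by auto
qed

lemma standard_ordering_eigenbasis:
  assumes "standard_ordering X Y Z t"
  obtains v where "ordered_basis v" "inj_on t {..d}" "\<And>j. j \<le> d \<Longrightarrow> X (v j) = t j *s v j"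
  using assms
  by (auto simp: standard_ordering_def leonard_basis_def eigenspace_def bij_betw_def)

lemma W_map_eigenbasis:
  assumes basis: "ordered_basis v" and t: "inj_on (theta q d a) {..d}"
    and X: "Vector_Spaces.linear scale scale X"
    and eig: "\<And>j. j \<le> d \<Longrightarrow> X (v j) = theta q d a j *s v j"
  shows "Vector_Spaces.linear scale scale (W_map q a X)"
    and "\<And>j. j \<le> d \<Longrightarrow> W_map q a X (v j) = W_eigenvalue q d a j *s v j"
proof -
  note E = primitive_idempotent_eigenbasis[OF basis t X eig]
  have W: "W_map q a X = (\<lambda>x. \<Sum>i\<le>d. W_eigenvalue q d a i
      *s primitive_idempotent X (theta q d a i) x)"
    by (rule ext) (simp add: W_map_def W_eigenvalue_def)
  show "Vector_Spaces.linear scale scale (W_map q a X)"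
    unfolding W by (rule linear_combination_linear) (simp add: E(1))
  fix j assume j: "j \<le> d"
  have "W_map q a X (v j) = (\<Sum>i\<le>d. if i = j then W_eigenvalue q d a j *s v j else 0)"
    unfolding W using j by (intro sum.cong refl) (auto simp: E(2))
  then show "W_map q a X (v j) = W_eigenvalue q d a j *s v j" using j by simp
qed

lemma shifted_product_combination_eigenvector:
  assumes "Vector_Spaces.linear scale scale X" "X v = x *s v"
  shows "(\<Sum>i\<le>d. r i *s shifted_product X t i v)
    = (\<Sum>i\<le>d. r i * (\<Prod>k<i. x - t k)) *s v"
  by (simp add: shifted_product_eigenvector[OF assms] scale_sum_left)

text \<open>
  A map with nonzero scalars on a basis is inverted by the map with the reciprocal scalars;
  here the square is inverted, so that only its reciprocal \<open>G\<close> has to be given.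
\<close>

lemma diagonal_inverse_square:
  assumes basis: "ordered_basis v"
    and W: "Vector_Spaces.linear scale scale W" "\<And>j. j \<le> d \<Longrightarrow> W (v j) = w j *s v j"
    and G: "Vector_Spaces.linear scale scale G"
      "\<And>j. j \<le> d \<Longrightarrow> G (v j) = inverse ((w j)\<^sup>2) *s v j"
    and nz: "\<And>j. j \<le> d \<Longrightarrow> w j \<noteq> 0"
  shows "bij W" and "inv W \<circ> inv W = G"
proof -
  note lin = linear_iff_additive_homogeneous
  have WWG: "(\<lambda>x. W (W (G x))) = (\<lambda>x. x)"
    by (rule linear_eq_on_ordered_basis[OF basis])
      (use W G nz in \<open>auto simp: lin power2_eq_square field_simps\<close>)
  have GWW: "(\<lambda>x. G (W (W x))) = (\<lambda>x. x)"
    by (rule linear_eq_on_ordered_basis[OF basis])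
      (use W G nz in \<open>auto simp: lin power2_eq_square field_simps\<close>)
  show bij: "bij W"
  proof (rule bijI)
    show "inj W" using GWW by (metis injI)
    show "surj W" using WWG by (metis surjI)
  qed
  show "inv W \<circ> inv W = G"
  proof
    fix x
    have "inv W (inv W (W (W (G x)))) = G x"
      using bij by (simp add: bij_is_inj)
    then show "(inv W \<circ> inv W) x = G x" using fun_cong[OF WWG, of x] by simp
  qed
qed

end

section \<open>The expansions of \<open>W\<^sup>2\<close> and its inverse\<close>

theorem proposition11p2:
  fixes scale :: "'f::field \<Rightarrow> 'v::ab_group_add \<Rightarrow> 'v"
    and d :: nat and q a b c :: 'f and A B C W :: "'v \<Rightarrow> 'v"
  assumes "leonard_space scale d"
    and "huang_parameters q d a b c"
    and "leonard_space.q_racah_leonard_triple scale d q a b c A B C"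
    and "W = leonard_space.W_map scale d q a A"
  shows "bij W \<and>
    W \<circ> W = (\<lambda>v. \<Sum>i\<le>d.
      scale (a powi (- int i) * q powi (int i * int d) / q_pochhammer (q\<^sup>2) (q\<^sup>2) i)
        (leonard_space.shifted_product scale A (theta q d a) i v)) \<and>
    inv W \<circ> inv W = (\<lambda>v. \<Sum>i\<le>d.
      scale ((-1) ^ i * a powi int i * q powi (int i * (int i - int d + 1))
              / q_pochhammer (q\<^sup>2) (q\<^sup>2) i)
        (leonard_space.shifted_product scale A (theta q d a) i v))"
proof -
  interpret leonard_space scale d by fact
  have q: "q \<noteq> 0" and a: "a \<noteq> 0" and ne: "\<forall>k\<in>{1..d}. (q\<^sup>2) ^ k \<noteq> 1"
    using assms(2) by (auto simp: huang_parameters_def power_mult)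
  have A: "Vector_Spaces.linear scale scale A"
    and ord: "standard_ordering A B C (theta q d a)"
    using assms(3) by (auto simp: q_racah_leonard_triple_def leonard_triple_def)
  obtain v where basis: "ordered_basis v" and inj: "inj_on (theta q d a) {..d}"
    and eig: "\<And>j. j \<le> d \<Longrightarrow> A (v j) = scale (theta q d a j) (v j)"
    using standard_ordering_eigenbasis[OF ord] by blast
  note W = W_map_eigenbasis[OF basis inj A eig, folded assms(4)]
  let ?S = "\<lambda>r v. \<Sum>i\<le>d. scale (r i) (shifted_product A (theta q d a) i v)"
  have S: "Vector_Spaces.linear scale scale (?S r)" for r
    by (intro linear_combination_linear shifted_product_linear A)
  note S_eig = shifted_product_combination_eigenvector[OF A eig]
  have WW: "W \<circ> W =
    ?S (\<lambda>i. a powi (- int i) * q powi (int i * int d) / q_pochhammer (q\<^sup>2) (q\<^sup>2) i)"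
  proof (rule linear_eq_on_ordered_basis[OF basis _ S])
    show "Vector_Spaces.linear scale scale (W \<circ> W)"
      using W(1) by (simp add: linear_iff_additive_homogeneous)
    fix j assume j: "j \<le> d"
    have "(W \<circ> W) (v j) = scale ((W_eigenvalue q d a j)\<^sup>2) (v j)"
      using W j by (simp add: linear_iff_additive_homogeneous power2_eq_square)
    then show "(W \<circ> W) (v j) =
      ?S (\<lambda>i. a powi (- int i) * q powi (int i * int d) / q_pochhammer (q\<^sup>2) (q\<^sup>2) i) (v j)"
      unfolding S_eig[OF j] W_square_scalar_sum[OF q a j ne] .
  qed
  have G: "?S (\<lambda>i. (-1) ^ i * a powi int i * q powi (int i * (int i - int d + 1))
        / q_pochhammer (q\<^sup>2) (q\<^sup>2) i) (v j) = scale (inverse ((W_eigenvalue q d a j)\<^sup>2)) (v j)"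
    if j: "j \<le> d" for j
    unfolding S_eig[OF j] W_inverse_square_scalar_sum[OF q a j ne] ..
  show ?thesis
    using WW diagonal_inverse_square[OF basis W S G W_eigenvalue_nonzero[OF q a]] by blast
qed

end
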